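(* Let $G$ be a finite simple connected graph with $m>0$ edges. Then $$DSO(G) \le \sqrt{\frac{m^{2}}{2}+\frac{m}{8}\bigl(F(G)-2M_{2}(G)\bigr)}.$$ Equality holds if and only if $G$ is regular.
   Context: For a finite simple graph $G=(V(G),E(G))$, $d_u$ denotes the degree of the vertex $u$. The Diminished Sombor index is $DSO(G)=\sum_{uv\in E(G)}\frac{\sqrt{d_u^2+d_v^2}}{d_u+d_v}$. The forgotten index is $F(G)=\sum_{uv\in E(G)}(d_u^2+d_v^2)$ and the second Zagreb index is $M_2(G)=\sum_{uv\in E(G)}d_u d_v$. *)

theory Defs
  imports Complex_Main "Graph_Theory.Graph_Theory"
begin

(* A finite simple graph is a symmetric digraph (locale graph of Graph_Theory), so every
   undirected edge uv occurs there as the two arcs (u,v) and (v,u).  Edge counts and edge sums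
   must therefore range over the unordered pairs below, not over the arcs. *)
definition uedges :: "('a, 'b) pre_digraph \<Rightarrow> 'a set set" where
  "uedges G = (\<lambda>a. {tail G a, head G a}) ` arcs G"

(* By symmetry and the absence of multiple arcs, the out-degree is the number of neighbours;
   see also out_degree_eq_card_uedges. *)
abbreviation deg :: "('a, 'b) pre_digraph \<Rightarrow> 'a \<Rightarrow> nat" where
  "deg G v \<equiv> out_degree G v"

definition regular_graph :: "('a, 'b) pre_digraph \<Rightarrow> bool" where
  "regular_graph G \<longleftrightarrow> (\<exists>k. \<forall>v\<in>verts G. deg G v = k)"

(* An edge e = {u, v} has u \<noteq> v, so the sum and the product of f over e are
   f u + f v and f u * f v. *)
definition diminished_sombor_index :: "('a, 'b) pre_digraph \<Rightarrow> real" where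
  "diminished_sombor_index G =
     (\<Sum>e\<in>uedges G. sqrt (\<Sum>v\<in>e. (real (deg G v))\<^sup>2) / (\<Sum>v\<in>e. real (deg G v)))"

definition forgotten_index :: "('a, 'b) pre_digraph \<Rightarrow> real" where
  "forgotten_index G = (\<Sum>e\<in>uedges G. \<Sum>v\<in>e. (real (deg G v))\<^sup>2)"

definition second_zagreb_index :: "('a, 'b) pre_digraph \<Rightarrow> real" where
  "second_zagreb_index G = (\<Sum>e\<in>uedges G. \<Prod>v\<in>e. real (deg G v))"

lemma (in graph) uedges_iff:
  "e \<in> uedges G \<longleftrightarrow> (\<exists>u v. e = {u, v} \<and> u \<noteq> v \<and> u \<rightarrow>\<^bsub>G\<^esub> v \<and> v \<rightarrow>\<^bsub>G\<^esub> u)"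
proof
  assume "e \<in> uedges G"
  then obtain a where a: "a \<in> arcs G" "e = {tail G a, head G a}"
    by (auto simp: uedges_def)
  then have "tail G a \<rightarrow>\<^bsub>G\<^esub> head G a"
    by (auto simp: arcs_ends_conv)
  then show "\<exists>u v. e = {u, v} \<and> u \<noteq> v \<and> u \<rightarrow>\<^bsub>G\<^esub> v \<and> v \<rightarrow>\<^bsub>G\<^esub> u"
    using a no_loops arcs_ends_symmetric[OF sym_arcs] by blast
qed (auto simp: uedges_def arcs_ends_conv)

lemma (in graph) out_degree_eq_card_uedges:
  "out_degree G v = card {e \<in> uedges G. v \<in> e}"
proof -
  have inj: "inj_on (\<lambda>a. {tail G a, head G a}) (out_arcs G v)"
  proof (rule inj_onI)
    fix a b assume ab: "a \<in> out_arcs G v" "b \<in> out_arcs G v"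
      "{tail G a, head G a} = {tail G b, head G b}"
    then have "head G a = head G b"
      by (auto simp: doubleton_eq_iff)
    then show "a = b"
      using ab no_multi_arcs[of a b] by (auto simp: arc_to_ends_def)
  qed
  have "(\<lambda>a. {tail G a, head G a}) ` out_arcs G v = {e \<in> uedges G. v \<in> e}" (is "?L = ?R")
  proof
    show "?L \<subseteq> ?R" by (auto simp: uedges_def)
    show "?R \<subseteq> ?L"
    proof
      fix e assume "e \<in> ?R"
      then obtain w where "e = {v, w}" "v \<rightarrow>\<^bsub>G\<^esub> w"
        by (auto simp: uedges_iff)
      then show "e \<in> ?L" by (auto simp: arcs_ends_conv)
    qed
  qed
  then show ?thesis
    using card_image[OF inj] by (simp add: out_degree_def)
qed

end

theory Submission
  imports Defs "HOL-Analysis.Convex"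
begin

text \<open>
  For an edge whose ends have degrees \<open>a\<close> and \<open>b\<close>, the square of its contribution to the
  diminished Sombor index is
  \[ \frac{a^2+b^2}{(a+b)^2} = \frac12 + \frac{(a-b)^2}{2(a+b)^2}. \]
  Both ends of an edge have degree at least \<open>1\<close>, so \<open>a + b \<ge> 2\<close> and the square is at most
  \<open>1/2 + (a - b)\<^sup>2/8\<close>; equality forces \<open>a = b\<close>, since otherwise \<open>a + b > 2\<close>
  (\<open>edge_term_squared_le\<close> and \<open>edge_term_squared_eq_iff\<close>).  Summed over the edges, these bounds
  give \<open>m/2 + (F - 2 M\<^sub>2)/8\<close>, because \<open>(a - b)\<^sup>2 = (a\<^sup>2 + b\<^sup>2) - 2ab\<close>.  The Cauchy--Schwarz
  inequality bounds the square of the index by \<open>m\<close> times the sum of the squared contributions,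
  which is the claimed inequality.

  Equality in the final bound forces equality in the bound for every single edge, so adjacent
  vertices have equal degrees; along paths this spreads over the whole connected graph.
  Conversely, in a regular graph every edge contributes \<open>1/\<surd>2\<close>, and \<open>F = 2 M\<^sub>2\<close>.
\<close>

lemma edge_term_squared:
  fixes a b :: real
  assumes "a + b \<noteq> 0"
  shows "(sqrt (a\<^sup>2 + b\<^sup>2) / (a + b))\<^sup>2 = 1 / 2 + (a - b)\<^sup>2 / (2 * (a + b)\<^sup>2)"
proof -
  have "(sqrt (a\<^sup>2 + b\<^sup>2) / (a + b))\<^sup>2 = (a\<^sup>2 + b\<^sup>2) / (a + b)\<^sup>2"
    by (simp add: power_divide)
  also have "\<dots> = (2 * (a\<^sup>2 + b\<^sup>2)) / (2 * (a + b)\<^sup>2)"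
    by (rule mult_divide_mult_cancel_left[symmetric]) simp
  also have "2 * (a\<^sup>2 + b\<^sup>2) = (a + b)\<^sup>2 + (a - b)\<^sup>2"
    by (simp add: power2_sum power2_diff)
  also have "((a + b)\<^sup>2 + (a - b)\<^sup>2) / (2 * (a + b)\<^sup>2)
      = 1 / 2 + (a - b)\<^sup>2 / (2 * (a + b)\<^sup>2)"
    using assms by (simp add: add_divide_distrib)
  finally show ?thesis .
qed

lemma edge_term_squared_le:
  fixes a b :: real
  assumes "a + b \<ge> 2"
  shows "(sqrt (a\<^sup>2 + b\<^sup>2) / (a + b))\<^sup>2 \<le> 1 / 2 + (a - b)\<^sup>2 / 8"
proof -
  have "2\<^sup>2 \<le> (a + b)\<^sup>2"
    using assms by (intro power_mono) auto
  then have "(a - b)\<^sup>2 / (2 * (a + b)\<^sup>2) \<le> (a - b)\<^sup>2 / 8"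
    by (intro divide_left_mono) auto
  then show ?thesis
    using assms by (simp add: edge_term_squared)
qed

text \<open>
  The denominators \<open>2(a + b)\<^sup>2\<close> and \<open>8\<close> agree only for \<open>a + b = 2\<close>; with \<open>a, b \<ge> 1\<close> this again
  means \<open>a = b\<close>.
\<close>

lemma edge_term_squared_eq_iff:
  fixes a b :: real
  assumes "a \<ge> 1" "b \<ge> 1"
  shows "(sqrt (a\<^sup>2 + b\<^sup>2) / (a + b))\<^sup>2 = 1 / 2 + (a - b)\<^sup>2 / 8 \<longleftrightarrow> a = b"
proof
  assume eq: "(sqrt (a\<^sup>2 + b\<^sup>2) / (a + b))\<^sup>2 = 1 / 2 + (a - b)\<^sup>2 / 8"
  show "a = b"
  proof (rule ccontr)
    assume "a \<noteq> b"
    then have "2 < a + b"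
      using assms by linarith
    then have "2\<^sup>2 < (a + b)\<^sup>2"
      by (intro power_strict_mono) auto
    then have "(a - b)\<^sup>2 / (2 * (a + b)\<^sup>2) < (a - b)\<^sup>2 / 8"
      using \<open>a \<noteq> b\<close> by (intro divide_strict_left_mono) auto
    then show False
      using eq \<open>2 < a + b\<close> by (simp add: edge_term_squared)
  qed
next
  assume "a = b"
  have "a + b \<noteq> 0"
    using assms by linarith
  show "(sqrt (a\<^sup>2 + b\<^sup>2) / (a + b))\<^sup>2 = 1 / 2 + (a - b)\<^sup>2 / 8"
    unfolding edge_term_squared[OF \<open>a + b \<noteq> 0\<close>] using \<open>a = b\<close> by simp
qed

lemma (in fin_digraph) out_degree_pos_if_adj:
  assumes "u \<rightarrow>\<^bsub>G\<^esub> v"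
  shows "out_degree G u > 0"
proof -
  obtain a where "a \<in> out_arcs G u"
    using assms by (auto simp: arcs_ends_conv)
  then show ?thesis
    by (auto simp: out_degree_def card_gt_0_iff)
qed

text \<open>
  Connectedness is defined through the symmetric closure, whose reachability relation is that of
  the graph itself; a path between two vertices then transports the value.
\<close>

lemma (in sym_digraph) connected_imp_constant:
  assumes "Digraph_Component.connected G"
    and "\<And>u v. u \<rightarrow>\<^bsub>G\<^esub> v \<Longrightarrow> f u = f v"
  shows "\<exists>k. \<forall>v\<in>verts G. f v = k"
proof -
  have sc: "strongly_connected G"
    using assms(1) by (intro symmetric_connected_imp_strongly_connected sym_arcs)
  then obtain r where r: "r \<in> verts G"
    by (auto simp: strongly_connected_def)
  have "f v = f r" if "v \<in> verts G" for v
  proof -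
    have "r \<rightarrow>\<^sup>*\<^bsub>G\<^esub> v"
      using sc r that by (auto simp: strongly_connected_def)
    then show ?thesis
      by (induction rule: reachable_induct) (use assms(2) in auto)
  qed
  then show ?thesis
    by blast
qed

theorem theorem10:
  fixes G :: "('a, 'b) pre_digraph" and m :: nat
  assumes "graph G"
    and "Digraph_Component.connected G"
    and "m = card (uedges G)"
    and "m > 0"
  shows "diminished_sombor_index G
           \<le> sqrt ((real m)\<^sup>2 / 2 + real m / 8 * (forgotten_index G - 2 * second_zagreb_index G))
       \<and> (diminished_sombor_index G
            = sqrt ((real m)\<^sup>2 / 2 + real m / 8 * (forgotten_index G - 2 * second_zagreb_index G))
          \<longleftrightarrow> regular_graph G)"
proof -
  interpret graph G by fact
  define t where "t e = sqrt (\<Sum>v\<in>e. (real (deg G v))\<^sup>2) / (\<Sum>v\<in>e. real (deg G v))" for e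
  define q where
    "q e = 1 / 2 + ((\<Sum>v\<in>e. (real (deg G v))\<^sup>2) - 2 * (\<Prod>v\<in>e. real (deg G v))) / 8" for e
  let ?D = "diminished_sombor_index G"
  let ?R = "(real m)\<^sup>2 / 2 + real m / 8 * (forgotten_index G - 2 * second_zagreb_index G)"
  have D: "?D = (\<Sum>e\<in>uedges G. t e)"
    by (simp add: diminished_sombor_index_def t_def)
  have fin: "finite (uedges G)"
    by (simp add: uedges_def)
  \<comment> \<open>The linear form of \<open>q\<close> is what sums to \<open>F - 2 M\<^sub>2\<close>; on an edge it is the square used in the
    real inequalities.\<close>
  have t_edge: "t {u, v} = sqrt ((real (deg G u))\<^sup>2 + (real (deg G v))\<^sup>2)
                             / (real (deg G u) + real (deg G v))"
    and q_edge: "q {u, v} = 1 / 2 + (real (deg G u) - real (deg G v))\<^sup>2 / 8"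
    if "u \<noteq> v" for u v
    using that by (simp_all add: t_def q_def power2_diff)
  have deg_ge_1: "real (deg G u) \<ge> 1" if "u \<rightarrow>\<^bsub>G\<^esub> v" for u v
    using out_degree_pos_if_adj[OF that] by simp
  have t_le_q: "(t e)\<^sup>2 \<le> q e" if e_in: "e \<in> uedges G" for e
  proof -
    obtain u v where e: "e = {u, v}" "u \<noteq> v" and uv: "u \<rightarrow>\<^bsub>G\<^esub> v" "v \<rightarrow>\<^bsub>G\<^esub> u"
      using e_in by (auto simp: uedges_iff)
    show ?thesis
      unfolding e(1) t_edge[OF e(2)] q_edge[OF e(2)]
      using deg_ge_1[OF uv(1)] deg_ge_1[OF uv(2)] by (intro edge_term_squared_le) linarith
  qed
  have R: "?R = real m * (\<Sum>e\<in>uedges G. q e)"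
  proof -
    have q_sum: "(\<Sum>e\<in>uedges G. q e)
        = real m / 2 + (forgotten_index G - 2 * second_zagreb_index G) / 8"
      by (simp add: q_def sum.distrib sum_subtractf sum_divide_distrib[symmetric]
          sum_distrib_left[symmetric] forgotten_index_def second_zagreb_index_def assms(3))
    show ?thesis
      unfolding q_sum by (simp add: field_simps power2_eq_square)
  qed
  have CS: "?D\<^sup>2 \<le> real m * (\<Sum>e\<in>uedges G. (t e)\<^sup>2)"
    using sum_squared_le_sum_of_squares[of t "uedges G"] by (simp add: D assms(3) mult.commute)
  have sum_le: "(\<Sum>e\<in>uedges G. (t e)\<^sup>2) \<le> (\<Sum>e\<in>uedges G. q e)"
    by (intro sum_mono t_le_q)
  have "?D\<^sup>2 \<le> ?R"
    unfolding R using CS mult_left_mono[OF sum_le, of "real m"] by simp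
  then have bound: "?D \<le> sqrt ?R"
    by (rule real_le_rsqrt)
  moreover have "regular_graph G" if eq: "?D = sqrt ?R"
  proof -
    have "0 \<le> ?R"
      using \<open>?D\<^sup>2 \<le> ?R\<close> zero_le_power2[of ?D] by linarith
    then have "?D\<^sup>2 = ?R"
      by (simp add: eq)
    then have "real m * (\<Sum>e\<in>uedges G. q e) \<le> real m * (\<Sum>e\<in>uedges G. (t e)\<^sup>2)"
      using CS R by linarith
    \<comment> \<open>Equality in Cauchy--Schwarz would only say that all edges contribute equally.  Tightness
      of the edgewise comparison is what makes the degrees of adjacent vertices agree.\<close>
    then have sums_eq: "(\<Sum>e\<in>uedges G. (t e)\<^sup>2) = (\<Sum>e\<in>uedges G. q e)"
      using sum_le \<open>m > 0\<close> by simp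
    have "deg G u = deg G v" if uv: "u \<rightarrow>\<^bsub>G\<^esub> v" for u v
    proof -
      have vu: "v \<rightarrow>\<^bsub>G\<^esub> u" and "u \<noteq> v"
        using uv arcs_ends_symmetric[OF sym_arcs] no_loops by (auto simp: arcs_ends_conv)
      then have "{u, v} \<in> uedges G"
        using uv by (auto simp: uedges_iff)
      then have "(t {u, v})\<^sup>2 = q {u, v}"
        by (intro sum_mono_inv[OF sums_eq]) (use fin t_le_q in auto)
      then show ?thesis
        using edge_term_squared_eq_iff[OF deg_ge_1[OF uv] deg_ge_1[OF vu]]
        by (simp add: t_edge[OF \<open>u \<noteq> v\<close>] q_edge[OF \<open>u \<noteq> v\<close>])
    qed
    then show ?thesis
      unfolding regular_graph_def by (rule connected_imp_constant[OF assms(2)])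
  qed
  moreover have "?D = sqrt ?R" if "regular_graph G"
  proof -
    obtain k where k: "\<And>v. v \<in> verts G \<Longrightarrow> deg G v = k"
      using \<open>regular_graph G\<close> by (auto simp: regular_graph_def)
    have edge: "t e = sqrt (1 / 2) \<and> q e = 1 / 2" if e_in: "e \<in> uedges G" for e
    proof -
      obtain u v where e: "e = {u, v}" "u \<noteq> v" and uv: "u \<rightarrow>\<^bsub>G\<^esub> v"
        using e_in by (auto simp: uedges_iff)
      have "deg G u = k" "deg G v = k"
        using adj_in_verts[OF uv] by (auto intro: k)
      moreover from this have "real k \<ge> 1"
        using deg_ge_1[OF uv] by simp
      ultimately have "q e = 1 / 2" "(t e)\<^sup>2 = 1 / 2" "t e \<ge> 0"
        using edge_term_squared[of "real k" "real k"]
        unfolding e(1) t_edge[OF e(2)] q_edge[OF e(2)] by simp_all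
      then show ?thesis
        by (simp add: real_sqrt_unique)
    qed
    have "(\<Sum>e\<in>uedges G. t e) = (\<Sum>e\<in>uedges G. sqrt (1 / 2))"
      and "(\<Sum>e\<in>uedges G. q e) = (\<Sum>e\<in>uedges G. 1 / 2)"
      by (rule sum.cong; use edge in blast)+
    then have "?D = real m * sqrt (1 / 2)" "?R = (real m)\<^sup>2 * (1 / 2)"
      unfolding D R by (simp_all add: assms(3) power2_eq_square)
    then show ?thesis
      by (simp only: real_sqrt_mult real_sqrt_abs abs_of_nat)
  qed
  ultimately show ?thesis
    by blast
qed

end
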